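(* Let $(\Omega,\mathcal F,\mathbb P)$ be a probability space, $\mathcal G\subset\mathcal F$ a sub-$\sigma$-algebra, and $h:\mathcal P_2(\mathbb R^n\times U)\to\mathbb R$ a map with extension $\tilde h(\xi):=h(\mathscr P(\xi))$, $\xi\in\mathcal P_2(\mathbb R^n\times\mathcal P(U))$, where $\mathscr P(\xi)(dx,du):=\int_{\mathcal P(U)}q(du)\xi(dx,dq)$. Then for any $\mathbb R^n$-valued square-integrable random variable $X$ and any $U$-valued random variable $\alpha$, $\mathbb P$-a.s., $$\tilde h\big(\mathcal L((X,\delta_\alpha)|\mathcal G)\big)=h\big(\mathcal L((X,\alpha)|\mathcal G)\big),$$ where $\delta_\alpha$ is the Dirac measure at $\alpha$.
   Context: $U$ is a compact subset of a Banach space $(B,\|\cdot\|)$. $\mathcal P(U)$ is the set of Borel probability measures on $U$ with the topology induced by the Fortet–Mourier norm $\|q\|_{U,\rm FM}=\sup\{\int_Uf\,dq:f\text{ 1-Lipschitz on }U,\|f\|_\infty\le1\}$ (weak convergence). $\mathcal P_2(E)$: Borel probability measures on $E$ with finite second moment. $\mathcal L(\cdot|\mathcal G)$: regular conditional law given $\mathcal G$. *)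

theory Defs
  imports "HOL-Probability.Probability"
begin

definition metric_borel :: "'a metric \<Rightarrow> 'a measure" where
  "metric_borel m = sigma (mspace m) {S. openin (mtopology_of m) S}"

text \<open>The choice of the base point \<open>x\<^sub>0\<close> is immaterial by the triangle inequality.\<close>

definition P2 :: "'a metric \<Rightarrow> 'a measure set" where
  "P2 m = {\<mu>. prob_space \<mu> \<and> sets \<mu> = sets (metric_borel m) \<and>
      (\<exists>x\<^sub>0\<in>mspace m. integrable \<mu> (\<lambda>x. (mdist m x\<^sub>0 x)\<^sup>2))}"

lemma space_metric_borel [simp]: "space (metric_borel m) = mspace m"
  by (simp add: metric_borel_def space_measure_of_conv)

lemma sets_metric_borel:
  "sets (metric_borel m) = sigma_sets (mspace m) {S. openin (mtopology_of m) S}"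
  unfolding metric_borel_def
  by (rule sets_measure_of) (use openin_subset in force)

lemma openin_in_metric_borel: "openin (mtopology_of m) S \<Longrightarrow> S \<in> sets (metric_borel m)"
  by (auto simp: sets_metric_borel)

lemma sets_restrict_borel_generated:
  fixes U :: "'b::topological_space set"
  shows "sets (restrict_space borel U) = sigma_sets U {S. openin (top_of_set U) S}"
proof -
  have "sets (restrict_space borel U) = {id -` A \<inter> U |A. A \<in> sigma_sets UNIV {S. open S}}"
    by (auto simp: sets_restrict_space borel_def)
  also have "\<dots> = sigma_sets U {id -` A \<inter> U |A. A \<in> {S. open S}}"
    by (rule sigma_sets_vimage_commute) auto
  also have "{id -` A \<inter> U |A. A \<in> {S. open S}} = {S. openin (top_of_set U) S}"
    by (auto simp: openin_open)
  finally show ?thesis .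
qed

lemma sets_metric_borel_subspace:
  "sets (metric_borel (submetric euclidean_metric U)) = sets (restrict_space borel U)"
  by (simp add: sets_metric_borel mtopology_of_submetric sets_restrict_borel_generated)

lemma sets_metric_borel_prod:
  fixes m :: "'c metric"
  shows "sets (metric_borel (prod_metric (euclidean_metric :: 'a::{metric_space,second_countable_topology} metric) m))
    = sets (borel \<Otimes>\<^sub>M metric_borel m)"
proof -
  let ?E = "prod_metric (euclidean_metric :: 'a metric) m"
  let ?P = "borel \<Otimes>\<^sub>M metric_borel m :: ('a \<times> 'c) measure"
  have sp: "space ?P = mspace ?E"
    by (simp add: space_pair_measure)
  have "sets (metric_borel ?E) \<subseteq> sets ?P"
    unfolding sets_metric_borel
  proof (rule sets.sigma_sets_subset'[of _ ?P "mspace ?E"])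
    show "{S. openin (mtopology_of ?E) S} \<subseteq> sets ?P"
    proof safe
      fix W assume W: "openin (mtopology_of ?E) W"
      obtain \<B> :: "'a set set" where B: "countable \<B>" "topological_basis \<B>"
        using ex_countable_basis by blast
      define T where "T = (\<lambda>b. \<Union>{T. openin (mtopology_of m) T \<and> b \<times> T \<subseteq> W})"
      have "W = (\<Union>b\<in>\<B>. b \<times> T b)"
      proof (intro equalityI subsetI)
        fix z assume z: "z \<in> W"
        have W': "openin (prod_topology euclidean (mtopology_of m)) W"
          using W by simp
        obtain A C where AC: "open A" "openin (mtopology_of m) C" "fst z \<in> A" "snd z \<in> C" "A \<times> C \<subseteq> W"
          using W' z unfolding openin_prod_topology_alt
          by (metis open_openin prod.collapse)
        obtain b where b: "b \<in> \<B>" "fst z \<in> b" "b \<subseteq> A"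
          using B(2) AC(1,3) by (meson topological_basisE)
        have "b \<times> C \<subseteq> W"
          using b AC by blast
        then have "C \<subseteq> T b"
          using AC unfolding T_def by blast
        then show "z \<in> (\<Union>b\<in>\<B>. b \<times> T b)"
          using b AC by (intro UN_I[of b]) (auto simp: mem_Times_iff)
      next
        fix z assume "z \<in> (\<Union>b\<in>\<B>. b \<times> T b)"
        then show "z \<in> W"
          by (auto simp: T_def)
      qed
      moreover have "b \<times> T b \<in> sets ?P" if "b \<in> \<B>" for b
      proof (rule pair_measureI)
        show "b \<in> sets borel"
          using B(2) that by (simp add: topological_basis_open)
        show "T b \<in> sets (metric_borel m)"
          unfolding T_def by (rule openin_in_metric_borel) auto
      qed
      ultimately show "W \<in> sets ?P"
        using B(1) sets.countable_UN'[of \<B> "\<lambda>b. b \<times> T b" ?P] by auto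
    qed
    show "mspace ?E \<in> sets ?P"
      using sets.top[of ?P] sp by simp
  qed
  moreover have "sets ?P \<subseteq> sets (metric_borel ?E)"
  proof -
    have fst: "fst \<in> metric_borel ?E \<rightarrow>\<^sub>M borel"
    proof (rule borel_measurableI)
      fix S :: "'a set" assume "open S"
      then have "openin (mtopology_of ?E) (S \<times> mspace m)"
        using openin_topspace[of "mtopology_of m"] by (simp add: openin_prod_Times_iff)
      moreover have "fst -` S \<inter> space (metric_borel ?E) = S \<times> mspace m"
        by auto
      ultimately show "fst -` S \<inter> space (metric_borel ?E) \<in> sets (metric_borel ?E)"
        by (simp add: openin_in_metric_borel)
    qed
    have snd: "snd \<in> metric_borel ?E \<rightarrow>\<^sub>M metric_borel m"
      unfolding metric_borel_def[of m]
    proof (rule measurable_sigma_sets[OF sets_measure_of])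
      show "{S. openin (mtopology_of m) S} \<subseteq> Pow (mspace m)"
        using openin_subset by force
      then show "{S. openin (mtopology_of m) S} \<subseteq> Pow (mspace m)" .
      show "snd \<in> space (metric_borel ?E) \<rightarrow> mspace m"
        by auto
      fix S assume "S \<in> {S. openin (mtopology_of m) S}"
      then have S: "openin (mtopology_of m) S" by simp
      then have "openin (mtopology_of ?E) (UNIV \<times> S)"
        by (simp add: openin_prod_Times_iff)
      moreover have "snd -` S \<inter> space (metric_borel ?E) = UNIV \<times> S"
        using openin_subset[OF S] by auto
      ultimately show "snd -` S \<inter> space (metric_borel ?E) \<in> sets (metric_borel ?E)"
        by (simp add: openin_in_metric_borel)
    qed
    have "(\<lambda>z. (fst z, snd z)) \<in> metric_borel ?E \<rightarrow>\<^sub>M ?P"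
      using fst snd by (rule measurable_Pair)
    then have id: "(\<lambda>z. z) \<in> metric_borel ?E \<rightarrow>\<^sub>M ?P"
      by simp
    show ?thesis
    proof
      fix A assume A: "A \<in> sets ?P"
      then have "A \<subseteq> mspace ?E"
        using sets.sets_into_space[OF A] sp by simp
      then show "A \<in> sets (metric_borel ?E)"
        using measurable_sets[OF id A] by (simp add: Int_absorb2 vimage_def)
    qed
  qed
  ultimately show ?thesis by auto
qed

definition prob_measures :: "'b::metric_space set \<Rightarrow> 'b measure set" where
  "prob_measures U = {q. prob_space q \<and> sets q = sets (restrict_space borel U)}"

definition FM_test :: "'b::metric_space set \<Rightarrow> ('b \<Rightarrow> real) set" where
  "FM_test U = {f. 1-lipschitz_on U f \<and> (\<forall>u\<in>U. \<bar>f u\<bar> \<le> 1)}"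

text \<open>The Fortet--Mourier norm of the signed measure \<open>p - q\<close>.\<close>

definition FM_dist :: "'b::metric_space set \<Rightarrow> 'b measure \<Rightarrow> 'b measure \<Rightarrow> real" where
  "FM_dist U p q = (SUP f\<in>FM_test U. (\<integral>u. f u \<partial>p) - (\<integral>u. f u \<partial>q))"

text \<open>The value \<open>0\<close> outside of the carrier is irrelevant; it is there because
  \<^const>\<open>Metric_space\<close> demands a globally symmetric and nonnegative function.\<close>

definition FM_metric :: "'b::metric_space set \<Rightarrow> 'b measure metric" where
  "FM_metric U = metric (prob_measures U,
     \<lambda>p q. if p \<in> prob_measures U \<and> q \<in> prob_measures U then FM_dist U p q else 0)"

lemma prob_measuresD:
  assumes "p \<in> prob_measures U"
  shows "prob_space p" "sets p = sets (restrict_space borel U)" "space p = U"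
  using assms sets_eq_imp_space_eq[of p "restrict_space borel U"]
  by (auto simp: prob_measures_def space_restrict_space)

lemma FM_test_integral:
  assumes p: "p \<in> prob_measures U" and f: "f \<in> FM_test U"
  shows "integrable p f" "\<bar>\<integral>u. f u \<partial>p\<bar> \<le> 1"
proof -
  interpret prob_space p using prob_measuresD[OF p] by simp
  have "continuous_on U f"
    using f lipschitz_on_continuous_on by (auto simp: FM_test_def)
  then have "f \<in> borel_measurable (restrict_space borel U)"
    by (rule borel_measurable_continuous_on_restrict)
  then have [measurable]: "f \<in> borel_measurable p"
    using measurable_cong_sets[OF prob_measuresD(2)[OF p] refl] by blast
  have b: "AE u in p. norm (f u) \<le> 1"
    using f prob_measuresD(3)[OF p] by (auto simp: FM_test_def)
  show int: "integrable p f"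
    using b by (intro integrable_const_bound) auto
  have "\<bar>\<integral>u. f u \<partial>p\<bar> \<le> (\<integral>u. \<bar>f u\<bar> \<partial>p)"
    by simp
  also have "\<dots> \<le> (\<integral>u. 1 \<partial>p)"
    using int b by (intro integral_mono_AE) auto
  also have "\<dots> = 1"
    by (simp add: prob_space)
  finally show "\<bar>\<integral>u. f u \<partial>p\<bar> \<le> 1" .
qed

lemma zero_FM_test: "(\<lambda>_. 0) \<in> FM_test U"
  by (auto simp: FM_test_def lipschitz_on_def)

lemma uminus_FM_test: "f \<in> FM_test U \<Longrightarrow> (\<lambda>u. - f u) \<in> FM_test U"
  by (auto simp: FM_test_def lipschitz_on_def dist_real_def abs_minus_commute)

lemma FM_dist_bdd:
  assumes "p \<in> prob_measures U" "q \<in> prob_measures U"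
  shows "bdd_above ((\<lambda>f. (\<integral>u. f u \<partial>p) - (\<integral>u. f u \<partial>q)) ` FM_test U)"
proof (rule bdd_aboveI2[where M=2])
  fix f :: "'a \<Rightarrow> real" assume "f \<in> FM_test U"
  then show "(\<integral>u. f u \<partial>p) - (\<integral>u. f u \<partial>q) \<le> 2"
    using FM_test_integral(2)[OF assms(1), of f] FM_test_integral(2)[OF assms(2), of f] by linarith
qed

lemma FM_dist_ge:
  assumes "p \<in> prob_measures U" "q \<in> prob_measures U" "f \<in> FM_test U"
  shows "\<bar>(\<integral>u. f u \<partial>p) - (\<integral>u. f u \<partial>q)\<bar> \<le> FM_dist U p q"
proof -
  have "(\<integral>u. f u \<partial>p) - (\<integral>u. f u \<partial>q) \<le> FM_dist U p q"
    unfolding FM_dist_def using FM_dist_bdd[OF assms(1,2)] assms(3) by (intro cSUP_upper) auto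
  moreover have "(\<integral>u. - f u \<partial>p) - (\<integral>u. - f u \<partial>q) \<le> FM_dist U p q"
    unfolding FM_dist_def using FM_dist_bdd[OF assms(1,2)] uminus_FM_test[OF assms(3)]
    by (intro cSUP_upper[where x="\<lambda>u. - f u"]) auto
  ultimately show ?thesis
    by simp
qed

lemma FM_dist_le:
  assumes "\<And>f. f \<in> FM_test U \<Longrightarrow> (\<integral>u. f u \<partial>p) - (\<integral>u. f u \<partial>q) \<le> c"
  shows "FM_dist U p q \<le> c"
  unfolding FM_dist_def using zero_FM_test assms by (intro cSUP_least) auto

lemma FM_dist_nonneg:
  assumes "p \<in> prob_measures U" "q \<in> prob_measures U"
  shows "0 \<le> FM_dist U p q"
  using FM_dist_ge[OF assms zero_FM_test] by simp

lemma FM_dist_le_2: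
  assumes "p \<in> prob_measures U" "q \<in> prob_measures U"
  shows "FM_dist U p q \<le> 2"
proof (rule FM_dist_le)
  fix f :: "'a \<Rightarrow> real" assume "f \<in> FM_test U"
  then show "(\<integral>u. f u \<partial>p) - (\<integral>u. f u \<partial>q) \<le> 2"
    using FM_test_integral(2)[OF assms(1), of f] FM_test_integral(2)[OF assms(2), of f] by linarith
qed

definition FM_bump :: "'b::metric_space set \<Rightarrow> nat \<Rightarrow> 'b \<Rightarrow> real" where
  "FM_bump C k u = min (1 / Suc k) (infdist u C)"

lemma FM_bump_test: "FM_bump C k \<in> FM_test U"
proof -
  have "1-lipschitz_on U (FM_bump C k)"
  proof (rule lipschitz_onI)
    fix x y
    show "dist (FM_bump C k x) (FM_bump C k y) \<le> 1 * dist x y"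
      using infdist_triangle_abs[of x C y] by (auto simp: FM_bump_def dist_real_def)
  qed simp
  moreover have "\<bar>FM_bump C k u\<bar> \<le> 1" for u
  proof -
    have "FM_bump C k u \<le> 1 / Suc k"
      by (simp add: FM_bump_def)
    also have "\<dots> \<le> 1"
      by simp
    finally have "FM_bump C k u \<le> 1" .
    moreover have "0 \<le> FM_bump C k u"
      by (simp add: FM_bump_def infdist_nonneg)
    ultimately show ?thesis
      by simp
  qed
  ultimately show ?thesis
    by (auto simp: FM_test_def)
qed

lemma FM_bump_LIMSEQ:
  assumes p: "p \<in> prob_measures U" and S: "open S" "S \<noteq> UNIV"
  shows "(\<lambda>k. Suc k * (\<integral>u. FM_bump (-S) k u \<partial>p)) \<longlonglongrightarrow> measure p (U \<inter> S)"
proof -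
  interpret prob_space p using prob_measuresD[OF p] by simp
  have US: "U \<inter> S \<in> sets p"
    using S by (auto simp: prob_measuresD[OF p] sets_restrict_space)
  have "(\<lambda>k. \<integral>u. Suc k * FM_bump (-S) k u \<partial>p) \<longlonglongrightarrow> (\<integral>u. indicator (U \<inter> S) u \<partial>p)"
  proof (rule integral_dominated_convergence[where w="\<lambda>_. 1"])
    show "(indicat_real (U \<inter> S)) \<in> borel_measurable p"
      using US by simp
    show "(\<lambda>u. Suc k * FM_bump (-S) k u) \<in> borel_measurable p" for k
      using FM_test_integral(1)[OF p FM_bump_test] by (intro borel_measurable_times) auto
    show "AE u in p. norm (Suc k * FM_bump (-S) k u) \<le> 1" for k
    proof (rule AE_I2)
      fix u
      have "0 \<le> FM_bump (-S) k u" "FM_bump (-S) k u \<le> 1 / Suc k"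
        using infdist_nonneg[of u "-S"] by (auto simp: FM_bump_def)
      then show "norm (Suc k * FM_bump (-S) k u) \<le> 1"
        by (simp add: abs_mult field_simps)
    qed
    show "AE u in p. (\<lambda>k. Suc k * FM_bump (-S) k u) \<longlonglongrightarrow> indicat_real (U \<inter> S) u"
    proof (rule AE_I2)
      fix u assume "u \<in> space p"
      then have u: "u \<in> U"
        by (simp add: prob_measuresD[OF p])
      show "(\<lambda>k. Suc k * FM_bump (-S) k u) \<longlonglongrightarrow> indicat_real (U \<inter> S) u"
      proof (cases "u \<in> S")
        case False
        then show ?thesis
          by (simp add: FM_bump_def)
      next
        case True
        have pos: "0 < infdist u (-S)"
          using in_closed_iff_infdist_zero[of "-S" u] S True infdist_nonneg[of u "-S"]
          by fastforce
        obtain N where N: "1 / Suc N < infdist u (-S)"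
          using pos by (metis nat_approx_posE)
        have "Suc k * FM_bump (-S) k u = 1" if "k \<ge> N" for k
        proof -
          have "1 / real (Suc k) \<le> 1 / real (Suc N)"
            using that by (intro divide_left_mono) auto
          then show ?thesis
            using N by (simp add: FM_bump_def)
        qed
        then show ?thesis
          using u True by (intro tendsto_eventually) (auto simp: eventually_sequentially)
      qed
    qed
  qed simp
  then show ?thesis
    using US by (simp add: sets.Int_space_eq2)
qed

lemma prob_measures_eqI:
  assumes p: "p \<in> prob_measures U" and q: "q \<in> prob_measures U"
    and eq: "\<And>f. f \<in> FM_test U \<Longrightarrow> (\<integral>u. f u \<partial>p) = (\<integral>u. f u \<partial>q)"
  shows "p = q"
proof (rule measure_eqI_generator_eq[where E="{S. openin (top_of_set U) S}" and \<Omega>=U and A="\<lambda>_. U"])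
  interpret p: prob_space p using prob_measuresD[OF p] by simp
  interpret q: prob_space q using prob_measuresD[OF q] by simp
  show "Int_stable {S. openin (top_of_set U) S}"
    by (auto simp: Int_stable_def)
  show "sets p = sigma_sets U {S. openin (top_of_set U) S}"
       "sets q = sigma_sets U {S. openin (top_of_set U) S}"
    using prob_measuresD(2)[OF p] prob_measuresD(2)[OF q] by (simp_all add: sets_restrict_borel_generated)
  fix T assume "T \<in> {S. openin (top_of_set U) S}"
  then obtain S where S: "open S" "T = U \<inter> S"
    by (auto simp: openin_open)
  show "emeasure p T = emeasure q T"
  proof (cases "S = UNIV")
    case True
    then show ?thesis
      using p.emeasure_space_1 q.emeasure_space_1 S prob_measuresD(3)[OF p] prob_measuresD(3)[OF q]
      by simp
  next
    case False
    have "measure p T = measure q T"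
      using FM_bump_LIMSEQ[OF p S(1) False] FM_bump_LIMSEQ[OF q S(1) False] S(2)
      by (simp add: eq[OF FM_bump_test] LIMSEQ_unique)
    then show ?thesis
      by (simp add: p.emeasure_eq_measure q.emeasure_eq_measure)
  qed
next
  interpret p: prob_space p using prob_measuresD[OF p] by simp
  show "emeasure p U \<noteq> \<infinity>" by simp
qed (auto dest: openin_imp_subset)

lemma Metric_space_FM:
  "Metric_space (prob_measures U)
     (\<lambda>p q. if p \<in> prob_measures U \<and> q \<in> prob_measures U then FM_dist U p q else 0)"
proof
  fix p q :: "'a measure"
  show "0 \<le> (if p \<in> prob_measures U \<and> q \<in> prob_measures U then FM_dist U p q else 0)"
    by (simp add: FM_dist_nonneg)
  have *: "FM_dist U p q \<le> FM_dist U q p"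
    if "p \<in> prob_measures U" "q \<in> prob_measures U" for p q
  proof (rule FM_dist_le)
    fix f :: "'a \<Rightarrow> real" assume "f \<in> FM_test U"
    then show "(\<integral>u. f u \<partial>p) - (\<integral>u. f u \<partial>q) \<le> FM_dist U q p"
      using FM_dist_ge[OF that(2,1), of f] by linarith
  qed
  show "(if p \<in> prob_measures U \<and> q \<in> prob_measures U then FM_dist U p q else 0) =
    (if q \<in> prob_measures U \<and> p \<in> prob_measures U then FM_dist U q p else 0)"
    using *[of p q] *[of q p] by auto
next
  fix p q assume pq: "p \<in> prob_measures U" "q \<in> prob_measures U"
  have "p = q" if "FM_dist U p q = 0"
  proof (rule prob_measures_eqI[OF pq])
    fix f :: "'a \<Rightarrow> real" assume "f \<in> FM_test U"
    then show "(\<integral>u. f u \<partial>p) = (\<integral>u. f u \<partial>q)"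
      using FM_dist_ge[OF pq] that by force
  qed
  moreover have "FM_dist U p p = 0"
  proof (rule antisym)
    show "FM_dist U p p \<le> 0"
      by (rule FM_dist_le) simp
    show "0 \<le> FM_dist U p p"
      by (rule FM_dist_nonneg[OF pq(1) pq(1)])
  qed
  ultimately show "((if p \<in> prob_measures U \<and> q \<in> prob_measures U then FM_dist U p q else 0) = 0) = (p = q)"
    using pq by auto
next
  fix p q r assume pqr: "p \<in> prob_measures U" "q \<in> prob_measures U" "r \<in> prob_measures U"
  have "FM_dist U p r \<le> FM_dist U p q + FM_dist U q r"
  proof (rule FM_dist_le)
    fix f :: "'a \<Rightarrow> real" assume "f \<in> FM_test U"
    then show "(\<integral>u. f u \<partial>p) - (\<integral>u. f u \<partial>r) \<le> FM_dist U p q + FM_dist U q r"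
      using FM_dist_ge[OF pqr(1,2), of f] FM_dist_ge[OF pqr(2,3), of f] by linarith
  qed
  then show "(if p \<in> prob_measures U \<and> r \<in> prob_measures U then FM_dist U p r else 0)
    \<le> (if p \<in> prob_measures U \<and> q \<in> prob_measures U then FM_dist U p q else 0) +
      (if q \<in> prob_measures U \<and> r \<in> prob_measures U then FM_dist U q r else 0)"
    using pqr by simp
qed

lemma mspace_FM_metric [simp]: "mspace (FM_metric U) = prob_measures U"
  by (simp add: FM_metric_def Metric_space.mspace_metric Metric_space_FM)

lemma mdist_FM_metric:
  "p \<in> prob_measures U \<Longrightarrow> q \<in> prob_measures U \<Longrightarrow> mdist (FM_metric U) p q = FM_dist U p q"
  by (simp add: FM_metric_def Metric_space.mdist_metric Metric_space_FM)

lemma FM_test_integral_measurable: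
  assumes f: "f \<in> FM_test U"
  shows "(\<lambda>q. \<integral>u. f u \<partial>q) \<in> borel_measurable (metric_borel (FM_metric U))"
proof (rule borel_measurableI)
  fix S :: "real set" assume S: "open S"
  let ?A = "(\<lambda>q. \<integral>u. f u \<partial>q) -` S \<inter> space (metric_borel (FM_metric U))"
  have "openin (mtopology_of (FM_metric U)) ?A"
    unfolding mtopology_of_def Metric_space.openin_mtopology[OF Metric_space_mspace_mdist]
  proof (intro conjI allI impI)
    show "?A \<subseteq> mspace (FM_metric U)" by simp
    fix q assume "q \<in> ?A"
    then have q: "q \<in> prob_measures U" "(\<integral>u. f u \<partial>q) \<in> S" by auto
    then obtain e where e: "e > 0" "ball (\<integral>u. f u \<partial>q) e \<subseteq> S"
      using S openE by blast
    have "Metric_space.mball (mspace (FM_metric U)) (mdist (FM_metric U)) q e \<subseteq> ?A"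
    proof
      fix r assume "r \<in> Metric_space.mball (mspace (FM_metric U)) (mdist (FM_metric U)) q e"
      then have r: "r \<in> prob_measures U" "FM_dist U q r < e"
        using q Metric_space.in_mball[OF Metric_space_mspace_mdist[of "FM_metric U"], of r q e]
        by (auto simp: mdist_FM_metric)
      then have "(\<integral>u. f u \<partial>r) \<in> ball (\<integral>u. f u \<partial>q) e"
        using FM_dist_ge[OF q(1) r(1) f] by (simp add: dist_real_def)
      then show "r \<in> ?A" using e r by auto
    qed
    then show "\<exists>r>0. Metric_space.mball (mspace (FM_metric U)) (mdist (FM_metric U)) q r \<subseteq> ?A"
      using e(1) by blast
  qed
  then show "?A \<in> sets (metric_borel (FM_metric U))"
    by (rule openin_in_metric_borel)
qed

lemma FM_metric_kernel:
  "(\<lambda>q. q) \<in> metric_borel (FM_metric U) \<rightarrow>\<^sub>M prob_algebra (restrict_space borel U)"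
proof (rule measurable_prob_algebra_generated[OF sets_restrict_borel_generated])
  show "Int_stable {S. openin (top_of_set U) S}"
    by (auto simp: Int_stable_def)
  show "{S. openin (top_of_set U) S} \<subseteq> Pow U"
    by (auto dest: openin_imp_subset)
  fix q assume "q \<in> space (metric_borel (FM_metric U))"
  then show "prob_space q" "sets q = sets (restrict_space borel U)"
    by (auto simp: prob_measures_def)
next
  fix T assume "T \<in> {S. openin (top_of_set U) S}"
  then obtain S where S: "open S" "T = U \<inter> S"
    by (auto simp: openin_open)
  have "(\<lambda>q. measure q T) \<in> borel_measurable (metric_borel (FM_metric U))"
  proof (cases "S = UNIV")
    case True
    have "measure q T = 1" if "q \<in> prob_measures U" for q
      using prob_space.prob_space[of q] prob_measuresD[OF that] S True by simp
    then show ?thesis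
      by (subst measurable_cong[of _ _ "\<lambda>_. 1"]) auto
  next
    case False
    show ?thesis
    proof (rule borel_measurable_LIMSEQ_real)
      show "(\<lambda>q. Suc k * (\<integral>u. FM_bump (-S) k u \<partial>q)) \<in> borel_measurable (metric_borel (FM_metric U))" for k
        by (intro borel_measurable_times borel_measurable_const FM_test_integral_measurable FM_bump_test)
      fix q assume "q \<in> space (metric_borel (FM_metric U))"
      then show "(\<lambda>k. Suc k * (\<integral>u. FM_bump (-S) k u \<partial>q)) \<longlonglongrightarrow> measure q T"
        using FM_bump_LIMSEQ[of q U S] S False by simp
    qed
  qed
  then have "(\<lambda>q. ennreal (measure q T)) \<in> borel_measurable (metric_borel (FM_metric U))"
    by simp
  moreover have "emeasure q T = ennreal (measure q T)" if "q \<in> prob_measures U" for q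
    using prob_measuresD(1)[OF that] by (simp add: finite_measure.emeasure_eq_measure prob_space_def)
  ultimately show "(\<lambda>q. emeasure q T) \<in> borel_measurable (metric_borel (FM_metric U))"
    by (subst measurable_cong) auto
qed

abbreviation ctrl_metric :: "'b::metric_space set \<Rightarrow> ((real^'n) \<times> 'b) metric" where
  "ctrl_metric U \<equiv> prod_metric euclidean_metric (submetric euclidean_metric U)"

abbreviation relaxed_metric :: "'b::metric_space set \<Rightarrow> ((real^'n) \<times> 'b measure) metric" where
  "relaxed_metric U \<equiv> prod_metric euclidean_metric (FM_metric U)"

text \<open>The measure \<open>A \<mapsto> \<integral> q({u. (x, u) \<in> A}) \<xi>(dx, dq)\<close>, that is \<open>\<integral> q(du) \<xi>(dx, dq)\<close>.\<close>

definition mixture ::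
  "'b::metric_space set \<Rightarrow> ((real^'n) \<times> 'b measure) measure \<Rightarrow> ((real^'n) \<times> 'b) measure" where
  "mixture U \<xi> = measure_of (UNIV \<times> U) (sets (metric_borel (ctrl_metric U)))
     (\<lambda>A. \<integral>\<^sup>+z. emeasure (snd z) (Pair (fst z) -` A) \<partial>\<xi>)"

text \<open>Only the values of \<open>h\<close> on \<^term>\<open>P2 (ctrl_metric U)\<close> are meaningful;
  lemma \<open>mixture_P2\<close> below shows that \<^const>\<open>mixture\<close> takes its values there.\<close>

definition relaxed_ext ::
  "'b::metric_space set \<Rightarrow> (((real^'n) \<times> 'b) measure \<Rightarrow> real) \<Rightarrow> ((real^'n) \<times> 'b measure) measure \<Rightarrow> real" where
  "relaxed_ext U h \<xi> = h (mixture U \<xi>)"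

definition dirac :: "'b::metric_space set \<Rightarrow> 'b \<Rightarrow> 'b measure" where
  "dirac U u = return (restrict_space borel U) u"

definition regular_cond_law ::
  "'w measure \<Rightarrow> 'w measure \<Rightarrow> 'e measure \<Rightarrow> ('w \<Rightarrow> 'e) \<Rightarrow> ('w \<Rightarrow> 'e measure) \<Rightarrow> bool" where
  "regular_cond_law M G N Y \<kappa> \<longleftrightarrow>
     \<kappa> \<in> G \<rightarrow>\<^sub>M prob_algebra N \<and>
     (\<forall>A\<in>sets N. AE \<omega> in M. measure (\<kappa> \<omega>) A = real_cond_exp M G (\<lambda>\<omega>'. indicator A (Y \<omega>')) \<omega>)"

lemma sets_ctrl: 
  "sets (metric_borel (ctrl_metric U :: ((real^'n) \<times> 'b::metric_space) metric))
     = sets (borel \<Otimes>\<^sub>M restrict_space borel U)"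
  unfolding sets_metric_borel_prod
  by (rule sets_pair_measure_cong) (simp_all add: sets_metric_borel_subspace)

lemma mixture_kernel:
  "(\<lambda>z. distr (snd z) (metric_borel (ctrl_metric U)) (Pair (fst z)))
    \<in> metric_borel (relaxed_metric U :: ((real^'n) \<times> 'b::metric_space measure) metric)
      \<rightarrow>\<^sub>M subprob_algebra (metric_borel (ctrl_metric U))"
proof -
  let ?C = "metric_borel (ctrl_metric U) :: ((real^'n) \<times> 'b) measure"
  let ?R = "metric_borel (relaxed_metric U) :: ((real^'n) \<times> 'b measure) measure"
  have *: "measurable ?R X = measurable (borel \<Otimes>\<^sub>M metric_borel (FM_metric U)) X" for X :: "'x measure"
    by (rule measurable_cong_sets[OF sets_metric_borel_prod refl])
  have "(\<lambda>q. q) \<in> metric_borel (FM_metric U) \<rightarrow>\<^sub>M subprob_algebra (restrict_space borel U)"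
    by (rule measurable_prob_algebraD[OF FM_metric_kernel])
  then have snd: "snd \<in> ?R \<rightarrow>\<^sub>M subprob_algebra (restrict_space borel U)"
    unfolding * by measurable
  have fst: "fst \<in> ?R \<rightarrow>\<^sub>M borel"
    unfolding * by measurable
  have C: "measurable X ?C = measurable X (borel \<Otimes>\<^sub>M restrict_space borel U)" for X :: "'x measure"
    by (rule measurable_cong_sets[OF refl sets_ctrl])
  show ?thesis
  proof (rule measurable_distr2[OF _ snd])
    show "(\<lambda>(z, u). (fst z, u)) \<in> ?R \<Otimes>\<^sub>M restrict_space borel U \<rightarrow>\<^sub>M ?C"
      unfolding C using fst by measurable
  qed
qed

lemma mixture_eq_bind:
  fixes \<xi> :: "((real^'n) \<times> 'b::metric_space measure) measure"
  assumes \<xi>: "sets \<xi> = sets (metric_borel (relaxed_metric U))" and ne: "space \<xi> \<noteq> {}"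
  shows "mixture U \<xi> = \<xi> \<bind> (\<lambda>z. distr (snd z) (metric_borel (ctrl_metric U)) (Pair (fst z)))"
    (is "_ = \<xi> \<bind> ?K")
proof -
  let ?C = "metric_borel (ctrl_metric U) :: ((real^'n) \<times> 'b) measure"
  have K: "?K \<in> \<xi> \<rightarrow>\<^sub>M subprob_algebra ?C"
    using mixture_kernel measurable_cong_sets[OF \<xi> refl] by blast
  have sp: "space \<xi> = UNIV \<times> prob_measures U"
    using sets_eq_imp_space_eq[OF \<xi>] by simp
  have Kem: "emeasure (?K z) A = emeasure (snd z) (Pair (fst z) -` A)"
    if z: "z \<in> space \<xi>" and A: "A \<in> sets ?C" for z A
  proof -
    have q: "snd z \<in> prob_measures U" using z unfolding sp by (simp add: mem_Times_iff)
    have "measurable (snd z) ?C = measurable (restrict_space borel U) (borel \<Otimes>\<^sub>M restrict_space borel U)"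
      by (rule measurable_cong_sets[OF prob_measuresD(2)[OF q] sets_ctrl])
    then have "Pair (fst z) \<in> snd z \<rightarrow>\<^sub>M ?C"
      by (simp only: measurable_Pair1' space_borel UNIV_I)
    moreover have "Pair (fst z) -` A \<subseteq> U"
    proof
      fix u assume "u \<in> Pair (fst z) -` A"
      then have "(fst z, u) \<in> space ?C"
        using sets.sets_into_space[OF A] by (simp only: vimage_eq) (rule subsetD)
      then show "u \<in> U" by simp
    qed
    ultimately show ?thesis
      by (simp only: emeasure_distr[OF _ A] prob_measuresD(3)[OF q] Int_absorb2)
  qed
  have em: "emeasure (\<xi> \<bind> ?K) A = (\<integral>\<^sup>+z. emeasure (snd z) (Pair (fst z) -` A) \<partial>\<xi>)"
    if "A \<in> sets ?C" for A
    unfolding emeasure_bind[OF ne K that] by (rule nn_integral_cong) (rule Kem[OF _ that])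
  have sets_bind: "sets (\<xi> \<bind> ?K) = sets ?C"
    by (rule sets_bind[OF sets_distr ne])
  have "\<xi> \<bind> ?K = measure_of (space (\<xi> \<bind> ?K)) (sets (\<xi> \<bind> ?K)) (emeasure (\<xi> \<bind> ?K))"
    by (rule measure_of_of_measure[symmetric])
  also have "\<dots> = measure_of (UNIV \<times> U) (sets ?C) (emeasure (\<xi> \<bind> ?K))"
    unfolding sets_eq_imp_space_eq[OF sets_bind] sets_bind by simp
  also have "\<dots> = mixture U \<xi>"
    unfolding mixture_def
  proof (rule measure_of_eq)
    show "sets ?C \<subseteq> Pow (UNIV \<times> U)"
      using sets.space_closed[of ?C] by simp
    fix A assume "A \<in> sigma_sets (UNIV \<times> U) (sets ?C)"
    then have "A \<in> sets ?C"
      using sets.sigma_sets_eq[of ?C] by simp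
    then show "emeasure (\<xi> \<bind> ?K) A = (\<integral>\<^sup>+z. emeasure (snd z) (Pair (fst z) -` A) \<partial>\<xi>)"
      by (rule em)
  qed
  finally show ?thesis by (rule sym)
qed

lemma mixture_P2:
  fixes \<xi> :: "((real^'n) \<times> 'b::metric_space measure) measure"
  assumes U: "compact U" and \<xi>: "\<xi> \<in> P2 (relaxed_metric U)"
  shows "mixture U \<xi> \<in> P2 (ctrl_metric U)"
proof -
  let ?C = "metric_borel (ctrl_metric U) :: ((real^'n) \<times> 'b) measure"
  let ?K = "\<lambda>z. distr (snd z) ?C (Pair (fst z))"
  have sets: "sets \<xi> = sets (metric_borel (relaxed_metric U))"
    using \<xi> by (simp add: P2_def)
  interpret prob_space \<xi> using \<xi> by (simp add: P2_def)
  have sp: "space \<xi> = UNIV \<times> prob_measures U"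
    using sets_eq_imp_space_eq[OF sets] by simp
  have ne: "space \<xi> \<noteq> {}" by (rule not_empty)
  have mix: "mixture U \<xi> = \<xi> \<bind> ?K"
    by (rule mixture_eq_bind[OF sets ne])
  have K: "?K \<in> \<xi> \<rightarrow>\<^sub>M subprob_algebra ?C"
    using mixture_kernel measurable_cong_sets[OF sets refl] by blast
  have P: "Pair (fst z) \<in> snd z \<rightarrow>\<^sub>M ?C" if z: "z \<in> space \<xi>" for z
  proof -
    have q: "snd z \<in> prob_measures U" using z unfolding sp by (simp add: mem_Times_iff)
    have "measurable (snd z) ?C = measurable (restrict_space borel U) (borel \<Otimes>\<^sub>M restrict_space borel U)"
      by (rule measurable_cong_sets[OF prob_measuresD(2)[OF q] sets_ctrl])
    then show ?thesis
      by (simp only: measurable_Pair1' space_borel UNIV_I)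
  qed
  have q: "prob_space (snd z)" "space (snd z) = U" if z: "z \<in> space \<xi>" for z
    using z prob_measuresD[of "snd z" U] unfolding sp by (simp_all add: mem_Times_iff)
  have prob: "prob_space (mixture U \<xi>)"
    unfolding mix using q P by (intro prob_space_bind[OF _ K] AE_I2 prob_space.prob_space_distr)
  have sets_mix: "sets (mixture U \<xi>) = sets ?C"
    unfolding mix by (rule sets_bind[OF sets_distr ne])
  obtain a q0 where z0: "q0 \<in> prob_measures U"
    and int: "integrable \<xi> (\<lambda>z. (mdist (relaxed_metric U) (a, q0) z)\<^sup>2)"
    using \<xi> by (auto simp: P2_def)
  obtain u0 where u0: "u0 \<in> U"
    using prob_space.not_empty[OF prob_measuresD(1)[OF z0]] prob_measuresD(3)[OF z0] by auto
  obtain D where D: "\<And>u. u \<in> U \<Longrightarrow> dist u0 u \<le> D"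
    using compact_imp_bounded[OF U] bounded_any_center[of U u0] by auto
  let ?f = "\<lambda>y. (mdist (ctrl_metric U) (a, u0) y)\<^sup>2"
  have f_eq: "?f y = (dist a (fst y))\<^sup>2 + (dist u0 (snd y))\<^sup>2" for y
    by (simp add: prod_dist_def split_beta)
  have C: "measurable ?C X = measurable (borel \<Otimes>\<^sub>M restrict_space borel U) X" for X :: "real measure"
    by (rule measurable_cong_sets[OF sets_ctrl refl])
  have [measurable]: "dist u0 \<in> borel_measurable (restrict_space borel U)"
    by (intro borel_measurable_continuous_on_restrict continuous_intros)
  have f: "?f \<in> borel_measurable ?C"
    unfolding C f_eq by measurable
  have "(\<integral>\<^sup>+y. ennreal (?f y) \<partial>mixture U \<xi>) = (\<integral>\<^sup>+z. \<integral>\<^sup>+y. ennreal (?f y) \<partial>?K z \<partial>\<xi>)"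
    unfolding mix by (rule nn_integral_bind[OF _ K]) (use f in simp)
  also have "\<dots> \<le> (\<integral>\<^sup>+z. ennreal ((mdist (relaxed_metric U) (a, q0) z)\<^sup>2 + D\<^sup>2) \<partial>\<xi>)"
  proof (rule nn_integral_mono)
    fix z assume z: "z \<in> space \<xi>"
    interpret q: prob_space "snd z" using q[OF z] by simp
    have "(\<integral>\<^sup>+y. ennreal (?f y) \<partial>?K z) = (\<integral>\<^sup>+u. ennreal (?f (fst z, u)) \<partial>snd z)"
      by (rule nn_integral_distr[OF P[OF z]]) (use f in simp)
    also have "\<dots> \<le> (\<integral>\<^sup>+u. ennreal ((mdist (relaxed_metric U) (a, q0) z)\<^sup>2 + D\<^sup>2) \<partial>snd z)"
    proof (intro nn_integral_mono ennreal_leI)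
      fix u assume "u \<in> space (snd z)"
      then have "(dist u0 u)\<^sup>2 \<le> D\<^sup>2"
        using D q[OF z] by (intro power_mono) auto
      then show "?f (fst z, u) \<le> (mdist (relaxed_metric U) (a, q0) z)\<^sup>2 + D\<^sup>2"
        by (simp add: prod_dist_def split_beta add_increasing)
    qed
    finally show "(\<integral>\<^sup>+y. ennreal (?f y) \<partial>?K z) \<le> ennreal ((mdist (relaxed_metric U) (a, q0) z)\<^sup>2 + D\<^sup>2)"
      by (simp add: q.emeasure_space_1)
  qed
  also have "\<dots> < \<infinity>"
  proof -
    have "integrable \<xi> (\<lambda>z. (mdist (relaxed_metric U) (a, q0) z)\<^sup>2 + D\<^sup>2)"
      using int by simp
    then show ?thesis
      by (subst nn_integral_eq_integral) (auto intro!: AE_I2 add_nonneg_nonneg simp del: ennreal_plus)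
  qed
  finally have fin: "(\<integral>\<^sup>+y. ennreal (?f y) \<partial>mixture U \<xi>) < \<infinity>" .
  have "?f \<in> borel_measurable (mixture U \<xi>)"
    using f measurable_cong_sets[OF sets_mix refl] by blast
  then have "integrable (mixture U \<xi>) ?f"
    using fin by (intro integrableI_nonneg) auto
  then show ?thesis
    using prob sets_mix u0 unfolding P2_def by (auto intro!: bexI[of _ "(a, u0)"])
qed

end

theory Submission
  imports Defs
begin

text \<open>
  A regular conditional law \<open>\<kappa>\<close> of \<open>Y\<close> disintegrates its joint distribution with \<open>G\<close>:
  \<open>\<integral>\<^sub>B \<integral> f d\<kappa> dP = \<integral>\<^sub>B f(Y) dP\<close> for all \<open>B \<in> G\<close>. Hence, if a Markov kernel \<open>K\<close> sends \<open>Y\<close> to the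
  Dirac measure at \<open>Z\<close>, then \<open>\<kappa> \<bind> K\<close> is a regular conditional law of \<open>Z\<close>. The mixture is such a
  bind, with \<open>K (x, q) = \<delta>\<^sub>x \<otimes> q\<close>, and \<open>K (X, \<delta>\<^sub>\<alpha>) = \<delta>\<close> at \<open>(X, \<alpha>)\<close>; so \<open>mixture U \<kappa>'\<close> and \<open>\<kappa>\<close> are both
  regular conditional laws of \<open>(X, \<alpha>)\<close>. They agree almost surely because the Borel sets of
  \<open>\<real>\<^sup>n \<times> U\<close> are countably generated, and no regularity of \<open>h\<close> enters.
\<close>

section \<open>Countable generation of the Borel sets\<close>

definition countably_generated :: "'a measure \<Rightarrow> bool" where
  "countably_generated N \<longleftrightarrow>
     (\<exists>E. countable E \<and> E \<subseteq> Pow (space N) \<and> sets N = sigma_sets (space N) E)"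

lemma countably_generated_cong:
  assumes "sets N = sets L"
  shows "countably_generated N \<longleftrightarrow> countably_generated L"
  using assms sets_eq_imp_space_eq[OF assms] by (simp add: countably_generated_def)

text \<open>Adjoining the whole space leaves the generated \<sigma>-algebra unchanged and lets a
  single generator cover the space, as the product criterion \<open>sets_pair_eq\<close> and the
  uniqueness theorem for measures require.\<close>

lemma countably_generated_insert_space:
  assumes "countably_generated N"
  obtains E where "countable E" "E \<subseteq> Pow (space N)" "sets N = sigma_sets (space N) E" "space N \<in> E"
proof -
  obtain E where E: "countable E" "E \<subseteq> Pow (space N)" "sets N = sigma_sets (space N) E"
    using assms unfolding countably_generated_def by blast
  have "sigma_sets (space N) (insert (space N) E) = sigma_sets (space N) E"
    by (rule sigma_sets_eqI) (auto simp: sigma_sets_top)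
  then show thesis
    using E that[of "insert (space N) E"] by simp
qed

lemma countably_generated_pair:
  assumes "countably_generated N" "countably_generated L"
  shows "countably_generated (N \<Otimes>\<^sub>M L)"
proof -
  obtain E where E: "countable E" "E \<subseteq> Pow (space N)" "sets N = sigma_sets (space N) E" "space N \<in> E"
    using countably_generated_insert_space[OF assms(1)] .
  obtain F where F: "countable F" "F \<subseteq> Pow (space L)" "sets L = sigma_sets (space L) F" "space L \<in> F"
    using countably_generated_insert_space[OF assms(2)] .
  let ?R = "{a \<times> b |a b. a \<in> E \<and> b \<in> F}"
  have R: "?R = (\<lambda>(a, b). a \<times> b) ` (E \<times> F)"
    by auto
  have sub: "?R \<subseteq> Pow (space N \<times> space L)"
    using E(2) F(2) by blast
  have "sets (N \<Otimes>\<^sub>M L) = sets (sigma (space N \<times> space L) ?R)"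
    using E F by (intro sets_pair_eq[where Ca="{space N}" and Cb="{space L}"]) auto
  also have "\<dots> = sigma_sets (space N \<times> space L) ?R"
    by (rule sets_measure_of[OF sub])
  finally show ?thesis
    using sub E(1) F(1) unfolding countably_generated_def
    by (intro exI[of _ ?R]) (simp add: space_pair_measure R)
qed

text \<open>Finite intersections of generators form a \<pi>-system, still countable because a
  countable set has only countably many finite subsets. This is the family on which two conditional
  laws will be compared.\<close>

lemma countably_generated_Int_stable:
  assumes "countably_generated N"
  obtains E where "countable E" "E \<subseteq> Pow (space N)" "sets N = sigma_sets (space N) E"
    "space N \<in> E" "Int_stable E"
proof -
  obtain F where F: "countable F" "F \<subseteq> Pow (space N)" "sets N = sigma_sets (space N) F" "space N \<in> F"
    using countably_generated_insert_space[OF assms] .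
  \<comment> \<open>The empty \<open>D\<close> is excluded because \<open>\<Inter>{}\<close> is
    \<open>UNIV\<close>, which need not lie in the space.\<close>
  define E where "E = Inter ` {D. finite D \<and> D \<subseteq> F \<and> D \<noteq> {}}"
  have "F \<subseteq> E"
  proof
    fix a assume "a \<in> F"
    then show "a \<in> E"
      unfolding E_def by (intro image_eqI[of _ _ "{a}"]) auto
  qed
  have FN: "F \<subseteq> sets N"
    using F(3) by auto
  have EN: "E \<subseteq> sets N"
    proof (clarsimp simp: E_def)
    fix D assume "finite D" "D \<subseteq> F" "D \<noteq> {}"
    then show "\<Inter>D \<in> sets N"
      using FN sets.finite_INT[of D "\<lambda>a. a" N] by auto
  qed
  have "{D. finite D \<and> D \<subseteq> F \<and> D \<noteq> {}} \<subseteq> {D. finite D \<and> D \<subseteq> F}"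
    by auto
  then have "countable E"
    unfolding E_def using countable_Collect_finite_subset[OF F(1)]
    by (intro countable_image) (rule countable_subset)
  moreover have "E \<subseteq> Pow (space N)"
    using EN sets.sets_into_space by auto
  moreover have "sets N = sigma_sets (space N) E"
  proof
    show "sets N \<subseteq> sigma_sets (space N) E"
      unfolding F(3) using \<open>F \<subseteq> E\<close> by (rule sigma_sets_mono')
    show "sigma_sets (space N) E \<subseteq> sets N"
      using EN by (rule sets.sigma_sets_subset)
  qed
  moreover have "Int_stable E"
  proof (rule Int_stableI)
    fix a b assume "a \<in> E" "b \<in> E"
    then obtain C D where "a = \<Inter>C" "finite C" "C \<subseteq> F" "C \<noteq> {}"
      "b = \<Inter>D" "finite D" "D \<subseteq> F" "D \<noteq> {}"
      unfolding E_def by auto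
    then show "a \<inter> b \<in> E"
      unfolding E_def by (intro image_eqI[of _ _ "C \<union> D"]) (auto simp: Inter_Un_distrib)
  qed
  ultimately show thesis
    using that F(4) \<open>F \<subseteq> E\<close> by blast
qed

text \<open>The family \<open>\<B>\<close> consists of ambient open sets but has to act as a base
  only for the relative topology of \<open>U\<close>. Every relatively open set is then a countable
  union of traces of its members.\<close>

lemma countably_generated_restrict_borel:
  fixes U :: "'b::metric_space set"
  assumes basis: "countable \<B>" "\<And>S. S \<in> \<B> \<Longrightarrow> open S"
    and ex: "\<And>S u. open S \<Longrightarrow> u \<in> S \<inter> U \<Longrightarrow> \<exists>B\<in>\<B>. u \<in> B \<and> B \<inter> U \<subseteq> S"
  shows "countably_generated (restrict_space borel U)"
proof -
  let ?E = "(\<lambda>B. B \<inter> U) ` \<B>"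
  have "sigma_sets U {S. openin (top_of_set U) S} = sigma_sets U ?E"
  proof (rule sigma_sets_eqI)
    fix T assume "T \<in> {S. openin (top_of_set U) S}"
    then obtain S where S: "open S" "T = U \<inter> S"
      by (auto simp: openin_open)
    let ?D = "{C \<in> ?E. C \<subseteq> S}"
    have "T = \<Union>?D"
    proof
      show "T \<subseteq> \<Union>?D"
      proof
        fix u assume "u \<in> T"
        then obtain B where "B \<in> \<B>" "u \<in> B" "B \<inter> U \<subseteq> S"
          using ex[OF S(1), of u] S(2) by auto
        then show "u \<in> \<Union>?D"
          using \<open>u \<in> T\<close> S(2) by (intro UnionI[of "B \<inter> U"]) auto
      qed
    qed (use S(2) in auto)
    moreover have "countable ?D"
      using basis(1) by (intro countable_subset[of ?D ?E]) auto
    then have "\<Union>?D \<in> sigma_sets U ?E"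
      by (rule sigma_sets_UNION) auto
    ultimately show "T \<in> sigma_sets U ?E"
      by simp
  next
    fix T assume "T \<in> ?E"
    then show "T \<in> sigma_sets U {S. openin (top_of_set U) S}"
      using basis(2) by (auto simp: openin_open)
  qed
  then show ?thesis
    unfolding countably_generated_def sets_restrict_borel_generated
    using basis(1) by (intro exI[of _ ?E]) (auto simp: space_restrict_space)
qed

text \<open>The ambient type is only a metric space, so a countable base has to come from
  compactness: total boundedness gives finite nets at every scale \<open>1 / Suc n\<close>, and the
  balls around their points serve as the base.\<close>

lemma countably_generated_compact:
  fixes U :: "'b::metric_space set"
  assumes "compact U"
  shows "countably_generated (restrict_space borel U)"
proof -
  have "\<exists>k. finite k \<and> U \<subseteq> (\<Union>x\<in>k. ball x (1 / Suc n))" for n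
    using assms unfolding compact_eq_totally_bounded by simp
  then obtain k where k: "\<And>n. finite (k n)" "\<And>n. U \<subseteq> (\<Union>x\<in>k n. ball x (1 / Suc n))"
    by metis
  let ?B = "\<Union>n. (\<lambda>x. ball x (1 / Suc n)) ` k n"
  show ?thesis
  proof (rule countably_generated_restrict_borel[of ?B])
    show "countable ?B"
      by (intro countable_UN countable_image countable_finite[OF k(1)]) simp
    fix S u assume S: "open S" "u \<in> S \<inter> U"
    then obtain e where e: "0 < e" "ball u e \<subseteq> S"
      using openE by blast
    \<comment> \<open>Half of \<open>e\<close> suffices: a ball of radius \<open>1 / Suc n\<close>
      that contains \<open>u\<close> has all its points within twice that radius of
      \<open>u\<close>.\<close>
    then obtain n where n: "1 / Suc n < e / 2"
      by (metis half_gt_zero nat_approx_posE)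
    obtain x where x: "x \<in> k n" "u \<in> ball x (1 / Suc n)"
      using k(2)[of n] S(2) by blast
    have "ball x (1 / Suc n) \<subseteq> ball u e"
    proof
      fix y assume "y \<in> ball x (1 / Suc n)"
      then show "y \<in> ball u e"
        using x(2) n dist_triangle[of u y x] by (simp add: dist_commute)
    qed
    then show "\<exists>B\<in>?B. u \<in> B \<and> B \<inter> U \<subseteq> S"
      using x e(2) by (intro bexI[of _ "ball x (1 / Suc n)"]) auto
  qed auto
qed

lemma countably_generated_borel: "countably_generated (borel :: 'a::second_countable_topology measure)"
proof -
  obtain B :: "'a set set" where B: "countable B" "topological_basis B"
    using ex_countable_basis by blast
  then have "sets borel = sigma_sets UNIV B"
    by (simp add: borel_eq_countable_basis)
  then show ?thesis
    unfolding countably_generated_def using B by auto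
qed

lemma countably_generated_ctrl:
  fixes U :: "'b::metric_space set"
  assumes "compact U"
  shows "countably_generated (metric_borel (ctrl_metric U) :: ((real^'n) \<times> 'b) measure)"
  unfolding countably_generated_cong[OF sets_ctrl]
  by (intro countably_generated_pair countably_generated_borel countably_generated_compact assms)

text \<open>The strict sublevel sets are open balls. This makes the squared distance an admissible
  integrand when second moments are computed.\<close>

lemma measurable_mdist:
  assumes "x \<in> mspace m"
  shows "mdist m x \<in> borel_measurable (metric_borel m)"
  unfolding borel_measurable_iff_less
proof
  fix c
  interpret m: Metric_space "mspace m" "mdist m"
    by (rule Metric_space_mspace_mdist)
  have "{y \<in> space (metric_borel m). mdist m x y < c} = m.mball x c"
    using assms by (auto simp: m.in_mball)
  moreover have "openin (mtopology_of m) (m.mball x c)"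
    unfolding mtopology_of_def by (rule m.openin_mball)
  ultimately show "{y \<in> space (metric_borel m). mdist m x y < c} \<in> sets (metric_borel m)"
    by (simp add: openin_in_metric_borel)
qed

section \<open>Regular conditional laws: integral criterion, transport, uniqueness, moments\<close>

context finite_measure_subalgebra
begin

text \<open>One direction is the averaging property of conditional expectation, the other its
  characterization by integrals over the sets of \<open>F\<close>. The bounds on \<open>g\<close>
  make all integrals finite, so that the identities may be stated in \<open>ennreal\<close>, where
  kernels are integrated.\<close>

lemma AE_eq_real_cond_exp_iff:
  assumes g: "g \<in> borel_measurable F" "\<And>x. 0 \<le> g x" "\<And>x. g x \<le> 1" and A: "A \<in> sets M"
  shows "(AE x in M. g x = real_cond_exp M F (indicator A) x) \<longleftrightarrow>
    (\<forall>B\<in>sets F. (\<integral>\<^sup>+x\<in>B. ennreal (g x) \<partial>M) = emeasure M (A \<inter> B))"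
proof -
  have gM [measurable]: "g \<in> borel_measurable M"
    by (rule measurable_from_subalg[OF subalg g(1)])
  have int: "integrable M g"
    using g by (intro integrable_const_bound[of _ 1]) auto
  have intA: "integrable M (indicator A :: _ \<Rightarrow> real)"
    using A by (simp add: integrable_indicator_iff less_top[symmetric])
  have FM: "B \<in> sets M" if "B \<in> sets F" for B
    using that subalg by (auto simp: subalgebra_def)
  have A_int: "(\<integral>x\<in>B. indicator A x \<partial>M) = measure M (A \<inter> B)" if "B \<in> sets F" for B
  proof -
    have "(\<integral>x\<in>B. indicator A x \<partial>M) = (\<integral>x. indicator (A \<inter> B) x \<partial>M)"
      unfolding set_lebesgue_integral_def by (intro Bochner_Integration.integral_cong) (auto simp: indicator_def)
    also have "\<dots> = measure M (A \<inter> B)"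
      using A FM[OF that] by simp
    finally show ?thesis .
  qed
  have g_int: "(\<integral>\<^sup>+x\<in>B. ennreal (g x) \<partial>M) = ennreal (\<integral>x\<in>B. g x \<partial>M)" if "B \<in> sets F" for B
  proof -
    have "(\<integral>\<^sup>+x\<in>B. ennreal (g x) \<partial>M) = (\<integral>\<^sup>+x. ennreal (indicator B x *\<^sub>R g x) \<partial>M)"
      by (intro nn_integral_cong) (auto simp: indicator_def)
    also have "\<dots> = ennreal (\<integral>x\<in>B. g x \<partial>M)"
      unfolding set_lebesgue_integral_def
      by (rule nn_integral_eq_integral) (use g(2) integrable_mult_indicator[OF FM[OF that] int] in \<open>simp_all\<close>)
    finally show ?thesis .
  qed
  have g_nn: "0 \<le> (\<integral>x\<in>B. g x \<partial>M)" for B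
    unfolding set_lebesgue_integral_def using g(2) by (intro Bochner_Integration.integral_nonneg) auto
  have "(\<forall>B\<in>sets F. (\<integral>\<^sup>+x\<in>B. ennreal (g x) \<partial>M) = emeasure M (A \<inter> B)) \<longleftrightarrow>
    (\<forall>B\<in>sets F. (\<integral>x\<in>B. indicator A x \<partial>M) = (\<integral>x\<in>B. g x \<partial>M))"
    using g_nn by (intro ball_cong) (auto simp: g_int A_int emeasure_eq_measure)
  also have "\<dots> \<longleftrightarrow> (AE x in M. g x = real_cond_exp M F (indicator A) x)"
  proof
    assume "\<forall>B\<in>sets F. (\<integral>x\<in>B. indicator A x \<partial>M) = (\<integral>x\<in>B. g x \<partial>M)"
    then have "AE x in M. real_cond_exp M F (indicator A) x = g x"
      using int intA g(1) by (intro real_cond_exp_charact) auto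
    then show "AE x in M. g x = real_cond_exp M F (indicator A) x"
      by eventually_elim simp
  next
    assume AE: "AE x in M. g x = real_cond_exp M F (indicator A) x"
    show "\<forall>B\<in>sets F. (\<integral>x\<in>B. indicator A x \<partial>M) = (\<integral>x\<in>B. g x \<partial>M)"
    proof
      fix B assume B: "B \<in> sets F"
      have "(\<integral>x\<in>B. indicator A x \<partial>M) = (\<integral>x\<in>B. real_cond_exp M F (indicator A) x \<partial>M)"
        by (rule real_cond_exp_intA[OF intA B])
      also have "\<dots> = (\<integral>x\<in>B. g x \<partial>M)"
        using AE FM[OF B] unfolding set_lebesgue_integral_def
        by (intro integral_cong_AE) (measurable, auto)
      finally show "(\<integral>x\<in>B. indicator A x \<partial>M) = (\<integral>x\<in>B. g x \<partial>M)" .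
    qed
  qed
  finally show ?thesis by simp
qed

text \<open>Trades almost sure equalities, whose null sets vary with \<open>A\<close>, for exact
  integral identities. Those are identities between measures and so extend from sets to
  functions.\<close>

lemma regular_cond_law_iff:
  assumes Y: "Y \<in> M \<rightarrow>\<^sub>M N"
  shows "regular_cond_law M F N Y \<kappa> \<longleftrightarrow> \<kappa> \<in> F \<rightarrow>\<^sub>M prob_algebra N \<and>
    (\<forall>A\<in>sets N. \<forall>B\<in>sets F. (\<integral>\<^sup>+\<omega>\<in>B. emeasure (\<kappa> \<omega>) A \<partial>M) = emeasure M (Y -` A \<inter> B))"
proof -
  have sp: "space F = space M"
    using subalg by (simp add: subalgebra_def)
  have "(AE \<omega> in M. measure (\<kappa> \<omega>) A = real_cond_exp M F (\<lambda>\<omega>'. indicator A (Y \<omega>')) \<omega>) \<longleftrightarrow>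
    (\<forall>B\<in>sets F. (\<integral>\<^sup>+\<omega>\<in>B. emeasure (\<kappa> \<omega>) A \<partial>M) = emeasure M (Y -` A \<inter> B))"
    if \<kappa>: "\<kappa> \<in> F \<rightarrow>\<^sub>M prob_algebra N" and A: "A \<in> sets N" for A
  proof -
    let ?A = "Y -` A \<inter> space M"
    have prob: "prob_space (\<kappa> \<omega>)" if "\<omega> \<in> space M" for \<omega>
      using measurable_space[OF \<kappa>, of \<omega>] that sp by (simp add: space_prob_algebra)
    \<comment> \<open>Outside \<open>space M\<close> nothing is known about
      \<open>\<kappa> \<omega>\<close>, while the criterion wants \<open>0 \<le> g \<le> 1\<close>
      everywhere; hence the cut-off at \<open>0\<close>.\<close>
    define g where "g = (\<lambda>\<omega>. if \<omega> \<in> space M then measure (\<kappa> \<omega>) A else 0)"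
    have [measurable]: "(\<lambda>\<omega>. measure (\<kappa> \<omega>) A) \<in> borel_measurable F"
      using measurable_compose[OF \<kappa> measurable_measure_prob_algebra[OF A]] .
    have "g \<in> borel_measurable F"
      unfolding g_def by (subst measurable_cong[where g="\<lambda>\<omega>. measure (\<kappa> \<omega>) A"]) (auto simp: sp)
    moreover have "0 \<le> g \<omega>" "g \<omega> \<le> 1" for \<omega>
      using prob_space.prob_le_1[OF prob] by (auto simp: g_def)
    moreover have A': "?A \<in> sets M"
      using Y A by (rule measurable_sets)
    ultimately have iff: "(AE \<omega> in M. g \<omega> = real_cond_exp M F (indicator ?A) \<omega>) \<longleftrightarrow>
      (\<forall>B\<in>sets F. (\<integral>\<^sup>+\<omega>\<in>B. ennreal (g \<omega>) \<partial>M) = emeasure M (?A \<inter> B))"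
      by (intro AE_eq_real_cond_exp_iff)
    have [measurable]: "(\<lambda>\<omega>. indicator A (Y \<omega>) :: real) \<in> borel_measurable M"
      using measurable_compose[OF Y borel_measurable_indicator[OF A]] .
    have "AE \<omega> in M. real_cond_exp M F (indicator ?A) \<omega> = real_cond_exp M F (\<lambda>\<omega>'. indicator A (Y \<omega>')) \<omega>"
    proof (rule real_cond_exp_cong)
      show "AE \<omega> in M. indicator ?A \<omega> = (indicator A (Y \<omega>) :: real)"
        by (rule AE_I2) (simp add: indicator_def)
      show "indicator ?A \<in> borel_measurable M"
        using A' by simp
    qed measurable
    with AE_space have "AE \<omega> in M. g \<omega> = real_cond_exp M F (indicator ?A) \<omega> \<longleftrightarrow>
      measure (\<kappa> \<omega>) A = real_cond_exp M F (\<lambda>\<omega>'. indicator A (Y \<omega>')) \<omega>"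
      by eventually_elim (simp add: g_def)
    then have "(AE \<omega> in M. g \<omega> = real_cond_exp M F (indicator ?A) \<omega>) \<longleftrightarrow>
      (AE \<omega> in M. measure (\<kappa> \<omega>) A = real_cond_exp M F (\<lambda>\<omega>'. indicator A (Y \<omega>')) \<omega>)"
      by (rule eventually_subst)
    moreover have "(\<integral>\<^sup>+\<omega>\<in>B. ennreal (g \<omega>) \<partial>M) = (\<integral>\<^sup>+\<omega>\<in>B. emeasure (\<kappa> \<omega>) A \<partial>M)" for B
      using prob by (intro nn_integral_cong) (auto simp: g_def prob_space_def finite_measure.emeasure_eq_measure)
    moreover have "?A \<inter> B = Y -` A \<inter> B" if "B \<in> sets F" for B
      using sets.sets_into_space[OF that] sp by auto
    ultimately show ?thesis
      using iff by simp
  qed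
  then show ?thesis
    unfolding regular_cond_law_def by auto
qed

text \<open>Restrict \<open>M\<close> to \<open>B\<close>. The integral criterion says that pushing
  this measure through the kernel \<open>\<kappa>\<close> and pushing it forward by \<open>Y\<close>
  give the same measure on \<open>N\<close>; integrating \<open>f\<close> against it yields the
  claim.\<close>

lemma nn_integral_regular_cond_law:
  assumes \<kappa>: "regular_cond_law M F N Y \<kappa>" and Y: "Y \<in> M \<rightarrow>\<^sub>M N"
    and f: "f \<in> borel_measurable N" and B: "B \<in> sets F"
  shows "(\<integral>\<^sup>+\<omega>\<in>B. (\<integral>\<^sup>+y. f y \<partial>\<kappa> \<omega>) \<partial>M) = (\<integral>\<^sup>+\<omega>\<in>B. f (Y \<omega>) \<partial>M)"
\<comment> \<open>Over an empty space \<open>bind\<close> takes a default value unrelated to the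
  kernel, so this case is split off.\<close>
proof (cases "space M = {}")
  case True
  then show ?thesis by (simp add: nn_integral_empty)
next
  case False
  let ?D = "density M (indicator B)"
  have BM: "B \<in> sets M"
    using B subalg by (auto simp: subalgebra_def)
  have "\<kappa> \<in> F \<rightarrow>\<^sub>M subprob_algebra N"
    using \<kappa> by (intro measurable_prob_algebraD) (simp add: regular_cond_law_def)
  then have \<kappa>M: "\<kappa> \<in> M \<rightarrow>\<^sub>M subprob_algebra N"
    by (rule measurable_from_subalg[OF subalg])
  then have \<kappa>D: "\<kappa> \<in> ?D \<rightarrow>\<^sub>M subprob_algebra N"
    by simp
  have YD: "Y \<in> ?D \<rightarrow>\<^sub>M N"
    using Y by simp
  have "?D \<bind> \<kappa> = distr ?D N Y"
  proof (rule measure_eqI)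
    have sets: "sets (?D \<bind> \<kappa>) = sets N"
      using False by (intro sets_bind sets_kernel[OF \<kappa>D]) simp_all
    then show "sets (?D \<bind> \<kappa>) = sets (distr ?D N Y)"
      by simp
    fix A assume "A \<in> sets (?D \<bind> \<kappa>)"
    then have A: "A \<in> sets N"
      by (simp only: sets)
    have m: "(\<lambda>\<omega>. emeasure (\<kappa> \<omega>) A) \<in> borel_measurable M"
      using measurable_compose[OF \<kappa>M measurable_emeasure_subprob_algebra[OF A]] .
    have YA: "Y -` A \<inter> space M \<in> sets M"
      using Y A by (rule measurable_sets)
    have "emeasure (?D \<bind> \<kappa>) A = (\<integral>\<^sup>+\<omega>. emeasure (\<kappa> \<omega>) A \<partial>?D)"
      using False by (intro emeasure_bind[OF _ \<kappa>D A]) simp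
    also have "\<dots> = (\<integral>\<^sup>+\<omega>\<in>B. emeasure (\<kappa> \<omega>) A \<partial>M)"
      using m BM by (simp add: nn_integral_density mult.commute)
    also have "\<dots> = emeasure M (Y -` A \<inter> B)"
      using \<kappa> A B unfolding regular_cond_law_iff[OF Y] by blast
    also have "Y -` A \<inter> B = B \<inter> (Y -` A \<inter> space M)"
      using sets.sets_into_space[OF BM] by blast
    also have "emeasure M \<dots> = emeasure ?D (Y -` A \<inter> space M)"
      using BM YA by (simp only: emeasure_density borel_measurable_indicator indicator_inter_arith[symmetric]
        nn_integral_indicator sets.Int)
    finally show "emeasure (?D \<bind> \<kappa>) A = emeasure (distr ?D N Y) A"
      using YD A by (simp add: emeasure_distr)
  qed
  then have "(\<integral>\<^sup>+\<omega>. (\<integral>\<^sup>+y. f y \<partial>\<kappa> \<omega>) \<partial>?D) = (\<integral>\<^sup>+\<omega>. f (Y \<omega>) \<partial>?D)"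
    using nn_integral_bind[OF f \<kappa>D] nn_integral_distr[OF YD, of f] f by simp
  then show ?thesis
    using BM measurable_compose[OF \<kappa>M nn_integral_measurable_subprob_algebra[OF f]] measurable_compose[OF Y f]
    by (simp add: nn_integral_density mult.commute)
qed

text \<open>Apply the disintegration to the function \<open>\<lambda>y. emeasure (K y) A\<close>. At
  \<open>Y \<omega>\<close> it is the Dirac mass at \<open>Z \<omega>\<close>, that is, the
  indicator of \<open>Z \<omega> \<in> A\<close>, and the integral criterion for \<open>Z\<close>
  results.\<close>

lemma regular_cond_law_bind:
  assumes \<kappa>: "regular_cond_law M F N Y \<kappa>" and Y: "Y \<in> M \<rightarrow>\<^sub>M N" and Z: "Z \<in> M \<rightarrow>\<^sub>M L"
    and K: "K \<in> N \<rightarrow>\<^sub>M prob_algebra L"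
    and KY: "\<And>\<omega>. \<omega> \<in> space M \<Longrightarrow> K (Y \<omega>) = return L (Z \<omega>)"
  shows "regular_cond_law M F L Z (\<lambda>\<omega>. \<kappa> \<omega> \<bind> K)"
  unfolding regular_cond_law_iff[OF Z]
proof (intro conjI ballI)
  have \<kappa>F: "\<kappa> \<in> F \<rightarrow>\<^sub>M prob_algebra N"
    using \<kappa> by (simp add: regular_cond_law_def)
  show "(\<lambda>\<omega>. \<kappa> \<omega> \<bind> K) \<in> F \<rightarrow>\<^sub>M prob_algebra L"
    by (rule measurable_bind_prob_space[OF \<kappa>F K])
  fix A B assume A: "A \<in> sets L" and B: "B \<in> sets F"
  have sp: "\<omega> \<in> space F" if "\<omega> \<in> space M" for \<omega>
    using that subalg by (simp add: subalgebra_def)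
  have BM: "B \<in> sets M"
    using B subalg by (auto simp: subalgebra_def)
  have ZA: "Z -` A \<inter> space M \<in> sets M"
    using Z A by (rule measurable_sets)
  have "(\<integral>\<^sup>+\<omega>\<in>B. emeasure (\<kappa> \<omega> \<bind> K) A \<partial>M) = (\<integral>\<^sup>+\<omega>\<in>B. (\<integral>\<^sup>+y. emeasure (K y) A \<partial>\<kappa> \<omega>) \<partial>M)"
    by (intro nn_integral_cong arg_cong2[where f="(*)"] refl)
      (rule emeasure_bind_prob_algebra[OF measurable_space[OF \<kappa>F sp] K A])
  also have "\<dots> = (\<integral>\<^sup>+\<omega>\<in>B. emeasure (K (Y \<omega>)) A \<partial>M)"
    by (rule nn_integral_regular_cond_law[OF \<kappa> Y _ B])
      (rule measurable_compose[OF measurable_prob_algebraD[OF K] measurable_emeasure_subprob_algebra[OF A]])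
  also have "\<dots> = (\<integral>\<^sup>+\<omega>. indicator ((Z -` A \<inter> space M) \<inter> B) \<omega> \<partial>M)"
    using A by (intro nn_integral_cong) (auto simp: KY indicator_def)
  also have "\<dots> = emeasure M ((Z -` A \<inter> space M) \<inter> B)"
    using ZA BM by simp
  also have "(Z -` A \<inter> space M) \<inter> B = Z -` A \<inter> B"
    using sets.sets_into_space[OF BM] by blast
  finally show "(\<integral>\<^sup>+\<omega>\<in>B. emeasure (\<kappa> \<omega> \<bind> K) A \<partial>M) = emeasure M (Z -` A \<inter> B)" .
qed

text \<open>For each set both measures are versions of the same conditional expectation. Over a
  countable \<pi>-system of generators the exceptional null sets merge into one, and outside it the
  two probability measures agree on all of \<open>N\<close>.\<close>

lemma regular_cond_law_unique:
  assumes \<kappa>: "regular_cond_law M F N Y \<kappa>" and \<kappa>': "regular_cond_law M F N Y \<kappa>'"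
    and N: "countably_generated N"
  shows "AE \<omega> in M. \<kappa> \<omega> = \<kappa>' \<omega>"
proof -
  obtain E where E: "countable E" "E \<subseteq> Pow (space N)" "sets N = sigma_sets (space N) E"
    "space N \<in> E" "Int_stable E"
    using countably_generated_Int_stable[OF N] .
  have "AE \<omega> in M. measure (\<kappa> \<omega>) A = measure (\<kappa>' \<omega>) A" if "A \<in> E" for A
  proof -
    have "A \<in> sets N"
      using that E(3) by auto
    then have "AE \<omega> in M. measure (\<kappa> \<omega>) A = real_cond_exp M F (\<lambda>\<omega>'. indicator A (Y \<omega>')) \<omega>"
      "AE \<omega> in M. measure (\<kappa>' \<omega>) A = real_cond_exp M F (\<lambda>\<omega>'. indicator A (Y \<omega>')) \<omega>"
      using \<kappa> \<kappa>' unfolding regular_cond_law_def by blast+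
    then show ?thesis
      by eventually_elim simp
  qed
  then have "AE \<omega> in M. \<forall>A\<in>E. measure (\<kappa> \<omega>) A = measure (\<kappa>' \<omega>) A"
    using E(1) by (simp add: AE_ball_countable)
  with AE_space show ?thesis
  proof eventually_elim
    case (elim \<omega>)
    have \<kappa>\<omega>: "\<kappa> \<omega> \<in> space (prob_algebra N)" "\<kappa>' \<omega> \<in> space (prob_algebra N)"
      using \<kappa> \<kappa>' elim(1) subalg measurable_space[of _ F "prob_algebra N" \<omega>]
      by (simp_all add: regular_cond_law_def subalgebra_def)
    then interpret \<kappa>: prob_space "\<kappa> \<omega>" by (simp add: space_prob_algebra)
    interpret \<kappa>': prob_space "\<kappa>' \<omega>" using \<kappa>\<omega> by (simp add: space_prob_algebra)
    show ?case
    proof (rule measure_eqI_generator_eq[OF E(5,2)])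
      show "emeasure (\<kappa> \<omega>) A = emeasure (\<kappa>' \<omega>) A" if "A \<in> E" for A
        using that elim(2) by (simp add: \<kappa>.emeasure_eq_measure \<kappa>'.emeasure_eq_measure)
      show "sets (\<kappa> \<omega>) = sigma_sets (space N) E" "sets (\<kappa>' \<omega>) = sigma_sets (space N) E"
        using \<kappa>\<omega> E(3) by (simp_all add: space_prob_algebra)
      show "range (\<lambda>_::nat. space N) \<subseteq> E" "(\<Union>i::nat. space N) = space N"
        using E(4) by auto
    qed simp
  qed
qed

text \<open>Disintegrating the squared distance over the whole space shows that the second moments
  of \<open>\<kappa> \<omega>\<close> average to that of \<open>Y\<close>. A nonnegative function
  with finite integral is finite almost everywhere.\<close>

lemma regular_cond_law_P2:
  assumes \<kappa>: "regular_cond_law M F (metric_borel m) Y \<kappa>" and Y: "Y \<in> M \<rightarrow>\<^sub>M metric_borel m"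
    and x: "x \<in> mspace m" and int: "integrable M (\<lambda>\<omega>. (mdist m x (Y \<omega>))\<^sup>2)"
  shows "AE \<omega> in M. \<kappa> \<omega> \<in> P2 m"
proof -
  let ?f = "\<lambda>y. (mdist m x y)\<^sup>2"
  have f: "?f \<in> borel_measurable (metric_borel m)"
    using measurable_mdist[OF x] by simp
  have \<kappa>F: "\<kappa> \<in> F \<rightarrow>\<^sub>M prob_algebra (metric_borel m)"
    using \<kappa> by (simp add: regular_cond_law_def)
  have sp: "space F \<in> sets F" "space F = space M"
    using subalg sets.top[of F] by (simp_all add: subalgebra_def)
  have "(\<integral>\<^sup>+\<omega>. (\<integral>\<^sup>+y. ?f y \<partial>\<kappa> \<omega>) \<partial>M) = (\<integral>\<^sup>+\<omega>\<in>space F. (\<integral>\<^sup>+y. ?f y \<partial>\<kappa> \<omega>) \<partial>M)"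
    by (intro nn_integral_cong) (simp add: sp)
  also have "\<dots> = (\<integral>\<^sup>+\<omega>\<in>space F. ?f (Y \<omega>) \<partial>M)"
    by (rule nn_integral_regular_cond_law[OF \<kappa> Y _ sp(1)]) (use f in simp)
  also have "\<dots> = (\<integral>\<^sup>+\<omega>. ?f (Y \<omega>) \<partial>M)"
    by (intro nn_integral_cong) (simp add: sp)
  also have "\<dots> < \<infinity>"
    using int by (subst nn_integral_eq_integral) auto
  finally have fin: "(\<integral>\<^sup>+\<omega>. (\<integral>\<^sup>+y. ?f y \<partial>\<kappa> \<omega>) \<partial>M) \<noteq> \<infinity>"
    by simp
  have "(\<lambda>\<omega>. \<integral>\<^sup>+y. ?f y \<partial>\<kappa> \<omega>) \<in> borel_measurable M"
    using f by (intro measurable_compose[OF measurable_from_subalg[OF subalg measurable_prob_algebraD[OF \<kappa>F]]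
      nn_integral_measurable_subprob_algebra]) simp
  from nn_integral_noteq_infinite[OF this fin] AE_space show ?thesis
  proof eventually_elim
    case (elim \<omega>)
    have P: "prob_space (\<kappa> \<omega>)" "sets (\<kappa> \<omega>) = sets (metric_borel m)"
      using measurable_space[OF \<kappa>F, of \<omega>] elim(2) by (simp_all add: sp space_prob_algebra)
    have "?f \<in> borel_measurable (\<kappa> \<omega>)"
      using f measurable_cong_sets[OF P(2) refl] by blast
    then have "integrable (\<kappa> \<omega>) ?f"
      using elim(1) by (intro integrableI_nonneg) (auto simp: less_top)
    then show ?case
      using P x unfolding P2_def by blast
  qed
qed

end

section \<open>Dirac measures and the mixture kernel\<close>

lemma dirac_prob_measures:
  assumes "u \<in> U"
  shows "dirac U u \<in> prob_measures U"
  unfolding prob_measures_def dirac_def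
  using assms by (simp add: prob_space_return space_restrict_space)

text \<open>A test function integrates against a Dirac measure to its value at the point, and it is
  1-Lipschitz. Hence \<open>dirac U\<close> is itself 1-Lipschitz on \<open>U\<close>.\<close>

lemma FM_dist_dirac_le:
  assumes "u \<in> U" "v \<in> U"
  shows "FM_dist U (dirac U u) (dirac U v) \<le> dist u v"
proof (rule FM_dist_le)
  fix f :: "'a \<Rightarrow> real" assume f: "f \<in> FM_test U"
  have "f \<in> borel_measurable (restrict_space borel U)"
    using f by (auto simp: FM_test_def intro!: borel_measurable_continuous_on_restrict lipschitz_on_continuous_on)
  then have "(\<integral>x. f x \<partial>dirac U w) = f w" if "w \<in> U" for w
    using that unfolding dirac_def by (intro integral_return) (simp_all add: space_restrict_space)
  moreover have "dist (f u) (f v) \<le> dist u v"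
    using f assms lipschitz_onD[of 1 U f u v] by (simp add: FM_test_def)
  ultimately show "(\<integral>x. f x \<partial>dirac U u) - (\<integral>x. f x \<partial>dirac U v) \<le> dist u v"
    using assms by (simp add: dist_real_def)
qed

text \<open>By the Lipschitz bound preimages of open sets are relatively open in \<open>U\<close>.
  This makes \<open>(X, dirac U \<alpha>)\<close> a random variable in the relaxed space.\<close>

lemma measurable_dirac: "dirac U \<in> restrict_space borel U \<rightarrow>\<^sub>M metric_borel (FM_metric U)"
  unfolding metric_borel_def
proof (rule measurable_measure_of)
  show "{S. openin (mtopology_of (FM_metric U)) S} \<subseteq> Pow (mspace (FM_metric U))"
    using openin_subset by force
  show "dirac U \<in> space (restrict_space borel U) \<rightarrow> mspace (FM_metric U)"
    by (simp add: dirac_prob_measures space_restrict_space)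
  fix S assume "S \<in> {S. openin (mtopology_of (FM_metric U)) S}"
  then have S: "openin (mtopology_of (FM_metric U)) S"
    by simp
  interpret FM: Metric_space "mspace (FM_metric U)" "mdist (FM_metric U)"
    by (rule Metric_space_mspace_mdist)
  have "openin (top_of_set U) (dirac U -` S \<inter> U)"
    unfolding openin_euclidean_subtopology_iff
  proof (intro conjI ballI)
    fix u assume u: "u \<in> dirac U -` S \<inter> U"
    then obtain e where e: "0 < e" "FM.mball (dirac U u) e \<subseteq> S"
      using S unfolding mtopology_of_def FM.openin_mtopology by auto
    have "dirac U v \<in> S" if "v \<in> U" "dist v u < e" for v
    proof -
      have "FM_dist U (dirac U u) (dirac U v) < e"
        using FM_dist_dirac_le[of u U v] u that by (simp add: dist_commute)
      then have "dirac U v \<in> FM.mball (dirac U u) e"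
        unfolding FM.in_mball using u that by (simp add: dirac_prob_measures mdist_FM_metric)
      then show ?thesis
        using e(2) by blast
    qed
    then show "\<exists>e>0. \<forall>v\<in>U. dist v u < e \<longrightarrow> v \<in> dirac U -` S \<inter> U"
      using e(1) by auto
  qed simp
  then show "dirac U -` S \<inter> space (restrict_space borel U) \<in> sets (restrict_space borel U)"
    by (auto simp: sets_restrict_borel_generated space_restrict_space)
qed

lemma measurable_Pair_ctrl:
  fixes x :: "real^'n"
  shows "Pair x \<in> restrict_space borel U \<rightarrow>\<^sub>M metric_borel (ctrl_metric U)"
  unfolding measurable_cong_sets[OF refl sets_ctrl]
  by (simp only: measurable_Pair1' space_borel UNIV_I)

text \<open>Upgrades \<open>mixture_kernel\<close> to a Markov kernel, the form that
  \<open>regular_cond_law_bind\<close> takes: image measures of probability measures have total mass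
  1.\<close>

lemma measurable_mixture_kernel:
  "(\<lambda>z. distr (snd z) (metric_borel (ctrl_metric U)) (Pair (fst z)))
    \<in> metric_borel (relaxed_metric U :: ((real^'n) \<times> 'b::metric_space measure) metric)
      \<rightarrow>\<^sub>M prob_algebra (metric_borel (ctrl_metric U))"
proof (rule measurable_prob_algebraI[OF _ mixture_kernel])
  fix z :: "(real^'n) \<times> 'b measure"
  assume "z \<in> space (metric_borel (relaxed_metric U))"
  then have q: "snd z \<in> prob_measures U"
    by (simp add: mem_Times_iff)
  have "Pair (fst z) \<in> snd z \<rightarrow>\<^sub>M metric_borel (ctrl_metric U)"
    using measurable_Pair_ctrl measurable_cong_sets[OF prob_measuresD(2)[OF q] refl] by blast
  then show "prob_space (distr (snd z) (metric_borel (ctrl_metric U)) (Pair (fst z)))"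
    by (rule prob_space.prob_space_distr[OF prob_measuresD(1)[OF q]])
qed

text \<open>Provides the condition \<open>KY\<close> of \<open>regular_cond_law_bind\<close> for the
  mixture kernel.\<close>

lemma distr_dirac:
  fixes x :: "real^'n"
  assumes "u \<in> U"
  shows "distr (dirac U u) (metric_borel (ctrl_metric U)) (Pair x) = return (metric_borel (ctrl_metric U)) (x, u)"
  unfolding dirac_def using assms
  by (intro distr_return measurable_Pair_ctrl) (simp add: space_restrict_space)

text \<open>The kernels are arbitrary versions of the two conditional laws. The two membership
  claims ensure that the equality evaluates \<open>h\<close> and its extension inside their
  domains.\<close>

theorem lemma2p3:
  fixes M G :: "'w measure"
    and U :: "'b::banach set"
    and h :: "((real^'n) \<times> 'b) measure \<Rightarrow> real"
    and X :: "'w \<Rightarrow> real^'n"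
    and \<alpha> :: "'w \<Rightarrow> 'b"
    and \<kappa> :: "'w \<Rightarrow> ((real^'n) \<times> 'b) measure"
    and \<kappa>' :: "'w \<Rightarrow> ((real^'n) \<times> 'b measure) measure"
  assumes "compact U"
    and "prob_space M"
    and "subalgebra M G"
    and "X \<in> borel_measurable M"
    and "integrable M (\<lambda>\<omega>. (norm (X \<omega>))\<^sup>2)"
    and "\<alpha> \<in> M \<rightarrow>\<^sub>M restrict_space borel U"
    and "regular_cond_law M G (metric_borel (ctrl_metric U)) (\<lambda>\<omega>. (X \<omega>, \<alpha> \<omega>)) \<kappa>"
    and "regular_cond_law M G (metric_borel (relaxed_metric U)) (\<lambda>\<omega>. (X \<omega>, dirac U (\<alpha> \<omega>))) \<kappa>'"
  shows "AE \<omega> in M. \<kappa>' \<omega> \<in> P2 (relaxed_metric U) \<and> \<kappa> \<omega> \<in> P2 (ctrl_metric U) \<and>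
    relaxed_ext U h (\<kappa>' \<omega>) = h (\<kappa> \<omega>)"
proof -
  interpret prob_space M by fact
  interpret finite_measure_subalgebra M G
    by unfold_locales fact
  let ?C = "metric_borel (ctrl_metric U) :: ((real^'n) \<times> 'b) measure"
  let ?R = "metric_borel (relaxed_metric U) :: ((real^'n) \<times> 'b measure) measure"
  let ?Y = "\<lambda>\<omega>. (X \<omega>, \<alpha> \<omega>)" and ?Y' = "\<lambda>\<omega>. (X \<omega>, dirac U (\<alpha> \<omega>))"
  let ?K = "\<lambda>z. distr (snd z) ?C (Pair (fst z))"
  note \<kappa> = assms(7) and \<kappa>' = assms(8)
  have \<alpha>U: "\<alpha> \<omega> \<in> U" if "\<omega> \<in> space M" for \<omega>
    using measurable_space[OF assms(6) that] by (simp add: space_restrict_space)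
  have Y: "?Y \<in> M \<rightarrow>\<^sub>M ?C"
    unfolding measurable_cong_sets[OF refl sets_ctrl] using assms(4,6) by (rule measurable_Pair)
  have Y': "?Y' \<in> M \<rightarrow>\<^sub>M ?R"
    unfolding measurable_cong_sets[OF refl sets_metric_borel_prod]
    using assms(4) measurable_compose[OF assms(6) measurable_dirac] by (rule measurable_Pair)
  \<comment> \<open>A probability space has a point, and \<open>\<alpha>\<close> maps it into
    \<open>U\<close>. The resulting \<open>u\<close> serves as base point in \<open>U\<close>, and
    \<open>dirac U u\<close> in the space of measures.\<close>
  obtain u where u: "u \<in> U"
    using not_empty \<alpha>U by blast
  obtain D where D: "\<And>v. v \<in> U \<Longrightarrow> dist u v \<le> D"
    using compact_imp_bounded[OF assms(1)] bounded_any_center[of U u] by auto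
  \<comment> \<open>A common dominating function for both squared distances: the first coordinate
    contributes the squared norm of \<open>X\<close>, the second at most \<open>D\<close>
    squared.\<close>
  have int_D: "integrable M (\<lambda>\<omega>. (norm (X \<omega>))\<^sup>2 + D\<^sup>2)"
    using assms(5) by simp
  have "AE \<omega> in M. \<kappa> \<omega> \<in> P2 (ctrl_metric U)"
  proof (rule regular_cond_law_P2[OF \<kappa> Y])
    show *: "(0, u) \<in> mspace (ctrl_metric U)"
      using u by simp
    show "integrable M (\<lambda>\<omega>. (mdist (ctrl_metric U) (0, u) (?Y \<omega>))\<^sup>2)"
    proof (rule Bochner_Integration.integrable_bound[OF int_D])
      show "(\<lambda>\<omega>. (mdist (ctrl_metric U) (0, u) (?Y \<omega>))\<^sup>2) \<in> borel_measurable M"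
        using measurable_compose[OF Y measurable_mdist[OF *]] by simp
      show "AE \<omega> in M. norm ((mdist (ctrl_metric U) (0, u) (?Y \<omega>))\<^sup>2) \<le> norm ((norm (X \<omega>))\<^sup>2 + D\<^sup>2)"
        using D \<alpha>U by (intro AE_I2) (simp add: prod_dist_def power_mono)
    qed
  qed
  moreover have "AE \<omega> in M. \<kappa>' \<omega> \<in> P2 (relaxed_metric U)"
  proof (rule regular_cond_law_P2[OF \<kappa>' Y'])
    show *: "(0, dirac U u) \<in> mspace (relaxed_metric U)"
      using u by (simp add: dirac_prob_measures)
    show "integrable M (\<lambda>\<omega>. (mdist (relaxed_metric U) (0, dirac U u) (?Y' \<omega>))\<^sup>2)"
    proof (rule Bochner_Integration.integrable_bound[OF int_D])
      show "(\<lambda>\<omega>. (mdist (relaxed_metric U) (0, dirac U u) (?Y' \<omega>))\<^sup>2) \<in> borel_measurable M"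
        using measurable_compose[OF Y' measurable_mdist[OF *]] by simp
      \<comment> \<open>The same \<open>D\<close> works for the measures because
        \<open>dirac U\<close> does not increase distances.\<close>
      have "FM_dist U (dirac U u) (dirac U v) \<le> D" if "v \<in> U" for v
        using FM_dist_dirac_le[OF u that] D[OF that] by simp
      then show "AE \<omega> in M. norm ((mdist (relaxed_metric U) (0, dirac U u) (?Y' \<omega>))\<^sup>2) \<le> norm ((norm (X \<omega>))\<^sup>2 + D\<^sup>2)"
        using u \<alpha>U by (intro AE_I2) (simp add: prod_dist_def power_mono mdist_FM_metric dirac_prob_measures FM_dist_nonneg)
    qed
  qed
  moreover have "AE \<omega> in M. \<kappa>' \<omega> \<bind> ?K = \<kappa> \<omega>"
  proof (rule regular_cond_law_unique[OF _ \<kappa> countably_generated_ctrl[OF assms(1)]])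
    show "regular_cond_law M G ?C ?Y (\<lambda>\<omega>. \<kappa>' \<omega> \<bind> ?K)"
      using \<alpha>U by (intro regular_cond_law_bind[OF \<kappa>' Y' Y measurable_mixture_kernel]) (simp add: distr_dirac)
  qed
  ultimately show ?thesis
  proof eventually_elim
    case (elim \<omega>)
    \<comment> \<open>Membership in \<open>P2\<close> supplies the \<sigma>-algebra and the nonempty
      space under which the mixture is a \<open>bind\<close>.\<close>
    then have "prob_space (\<kappa>' \<omega>)" "sets (\<kappa>' \<omega>) = sets ?R"
      by (simp_all add: P2_def)
    then have "mixture U (\<kappa>' \<omega>) = \<kappa> \<omega>"
      using elim(3) by (simp add: mixture_eq_bind prob_space.not_empty)
    then show ?case
      using elim by (simp add: relaxed_ext_def)
  qed
qed

end
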